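(* Let $\Omega$ be a finite probability space, let $\tilde y:\Omega\to\{1,\dots,N\}$ be a random variable distributed as $\hat{\boldsymbol p}=(\hat p_i)_{i=1}^N$ with $\hat p_i>0$ for all $i$, and let $\alpha\in[0,1]$. Then for any random variable $\tilde x:\Omega\to\mathbb R$, $$\mathrm{VaR}_\alpha[\tilde x]=\sup_{\boldsymbol\zeta\in\Delta_N}\Big\{\min_{i\in\{1,\dots,N\}}\mathrm{VaR}_{\alpha\zeta_i\hat p_i^{-1}}[\tilde x\mid\tilde y=i]\ \Big|\ \alpha\,\zeta_i\le\hat p_i\ \text{for all } i\Big\},$$ where the minimum is interpreted as $\infty$ if all its terms are infinite (which only occurs if $\alpha=1$).
   Context: $\Delta_N$ is the $N$-dimensional probability simplex. For a real random variable $\tilde x$ on a finite probability space and $\alpha\in[0,1]$, $$\mathrm{VaR}_\alpha[\tilde x]=\sup\{z\in\mathbb R\mid\mathbb P[\tilde x<z]\le\alpha\}=\inf\{z\in\mathbb R\mid\mathbb P[\tilde x\le z]>\alpha\},$$ with values in the extended reals; in particular $\mathrm{VaR}_1[\tilde x]=\infty$. $\mathrm{VaR}_\alpha[\tilde x\mid\tilde y=i]$ denotes the same quantity computed under the conditional distribution given $\tilde y=i$. *)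

theory Defs
  imports "HOL-Probability.Probability"
begin

definition VaR :: "'a measure \<Rightarrow> real \<Rightarrow> ('a \<Rightarrow> real) \<Rightarrow> ereal" where
  "VaR M \<alpha> X = Sup {ereal z | z. measure M {\<omega> \<in> space M. X \<omega> < z} \<le> \<alpha>}"

text \<open>The infimum form of the value at risk agrees with the supremum form.\<close>

lemma (in prob_space) VaR_eq_Inf:
  assumes X [measurable]: "X \<in> borel_measurable M"
  shows "VaR M \<alpha> X = Inf {ereal z | z. measure M {\<omega> \<in> space M. X \<omega> \<le> z} > \<alpha>}"
    (is "_ = Inf ?B")
proof (rule antisym)
  show "VaR M \<alpha> X \<le> Inf ?B"
    unfolding VaR_def
  proof (intro Sup_least Inf_greatest, clarsimp)
    fix z w
    assume zw: "prob {\<omega> \<in> space M. X \<omega> < z} \<le> \<alpha>" "\<alpha> < prob {\<omega> \<in> space M. X \<omega> \<le> w}"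
    show "z \<le> w"
    proof (rule ccontr)
      assume "\<not> z \<le> w"
      then have "prob {\<omega> \<in> space M. X \<omega> \<le> w} \<le> prob {\<omega> \<in> space M. X \<omega> < z}"
        by (intro finite_measure_mono) auto
      with zw show False by simp
    qed
  qed
next
  show "Inf ?B \<le> VaR M \<alpha> X"
  proof (rule ccontr)
    assume "\<not> Inf ?B \<le> VaR M \<alpha> X"
    then obtain c where c: "VaR M \<alpha> X < ereal c" "ereal c < Inf ?B"
      using ereal_dense2[of "VaR M \<alpha> X" "Inf ?B"] by (auto simp: not_le)
    have "\<not> prob {\<omega> \<in> space M. X \<omega> < c} \<le> \<alpha>"
    proof
      assume "prob {\<omega> \<in> space M. X \<omega> < c} \<le> \<alpha>"
      then have "ereal c \<le> VaR M \<alpha> X" unfolding VaR_def by (intro Sup_upper) auto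
      with c show False by simp
    qed
    moreover have "\<not> prob {\<omega> \<in> space M. X \<omega> \<le> c} > \<alpha>"
    proof
      assume "prob {\<omega> \<in> space M. X \<omega> \<le> c} > \<alpha>"
      then have "Inf ?B \<le> ereal c" by (intro Inf_lower) auto
      with c show False by simp
    qed
    moreover have "prob {\<omega> \<in> space M. X \<omega> < c} \<le> prob {\<omega> \<in> space M. X \<omega> \<le> c}"
      by (intro finite_measure_mono) auto
    ultimately show False by simp
  qed
qed

text \<open>For an event \<open>A\<close> of positive probability, \<open>uniform_measure M A\<close> is the conditional
  distribution on \<open>M\<close> given \<open>A\<close>, whatever \<open>M\<close> is (see \<open>measure_uniform_measure\<close>).\<close>

definition cond_VaR :: "'a measure \<Rightarrow> real \<Rightarrow> ('a \<Rightarrow> real) \<Rightarrow> ('a \<Rightarrow> 'b) \<Rightarrow> 'b \<Rightarrow> ereal" where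
  "cond_VaR M \<alpha> X Y i = VaR (uniform_measure M {\<omega> \<in> space M. Y \<omega> = i}) \<alpha> X"

text \<open>Vectors with \<open>N\<close> components are extensional functions on \<open>{1..N}\<close>.\<close>

definition prob_simplex :: "nat \<Rightarrow> (nat \<Rightarrow> real) set" where
  "prob_simplex N = {\<zeta> \<in> {1..N} \<rightarrow>\<^sub>E {0..}. (\<Sum>i=1..N. \<zeta> i) = 1}"

end

theory Submission
  imports Defs
begin

text \<open>Write \<open>q\<^sub>i(z) = P[X < z, Y = i]\<close>. Then \<open>P[X < z]\<close> is the sum of the \<open>q\<^sub>i(z)\<close>, while the
  conditional probability of \<open>X < z\<close> given \<open>Y = i\<close> is \<open>q\<^sub>i(z) / p\<^sub>i\<close>. The threshold condition for
  the conditional value at risk at level \<open>\<alpha> \<zeta>\<^sub>i / p\<^sub>i\<close> is therefore \<open>q\<^sub>i(z) \<le> \<alpha> \<zeta>\<^sub>i\<close>: the vector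
  \<open>\<alpha> \<zeta>\<close> distributes the budget \<open>\<alpha>\<close> for the event \<open>X < z\<close> over the values of \<open>Y\<close>.

  If a distribution of the budget allows \<open>z\<close> for every \<open>i\<close>, summation over \<open>i\<close> shows that \<open>z\<close> is
  allowed at level \<open>\<alpha>\<close> without conditioning. Conversely, if \<open>P[X < z] \<le> \<alpha>\<close>, there are numbers
  \<open>a\<^sub>i\<close> between \<open>q\<^sub>i(z)\<close> and \<open>p\<^sub>i\<close> with total exactly \<open>\<alpha>\<close>, since the totals of the two bounds are
  \<open>P[X < z] \<le> \<alpha>\<close> and \<open>1 \<ge> \<alpha>\<close> (\<open>ex_budget\<close>). For \<open>\<alpha> > 0\<close>, \<open>\<zeta> = a / \<alpha>\<close> is then a feasible
  distribution that allows \<open>z\<close> for every \<open>i\<close>; for \<open>\<alpha> = 0\<close> all \<open>a\<^sub>i\<close> vanish and any \<open>\<zeta>\<close> will do.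

  For the last claim: \<open>X\<close> takes finitely many values, so an infinite value at risk forces
  the level to be at least \<open>1\<close> (\<open>one_le_level_if_VaR_infinite\<close>). If this happens for all \<open>i\<close>, then
  \<open>\<alpha> \<zeta>\<^sub>i \<ge> p\<^sub>i\<close>, and summation gives \<open>\<alpha> \<ge> 1\<close>.\<close>

lemma le_VaR:
  assumes "measure M {\<omega> \<in> space M. X \<omega> < z} \<le> a"
  shows "ereal z \<le> VaR M a X"
  unfolding VaR_def using assms by (intro Sup_upper) auto

lemma (in finite_measure) measure_le_if_less_VaR:
  assumes [measurable]: "X \<in> borel_measurable M" and "ereal z < VaR M a X"
  shows "measure M {\<omega> \<in> space M. X \<omega> < z} \<le> a"
proof -
  obtain w where w: "z < w" "measure M {\<omega> \<in> space M. X \<omega> < w} \<le> a"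
    using assms(2) unfolding VaR_def less_Sup_iff by auto
  have "measure M {\<omega> \<in> space M. X \<omega> < z} \<le> measure M {\<omega> \<in> space M. X \<omega> < w}"
    using w(1) by (intro finite_measure_mono) auto
  with w(2) show ?thesis by simp
qed

lemma (in prob_space) one_le_level_if_VaR_infinite:
  assumes X: "X \<in> borel_measurable M" and fin: "finite (space M)" and "VaR M a X = \<infinity>"
  shows "1 \<le> a"
proof -
  define z where "z = Max (X ` space M) + 1"
  have "X \<omega> < z" if "\<omega> \<in> space M" for \<omega>
    unfolding z_def by (rule le_less_trans[OF Max_ge less_add_one]) (use fin that in auto)
  then have "{\<omega> \<in> space M. X \<omega> < z} = space M" by auto
  with measure_le_if_less_VaR[OF X, of z a] assms(3) prob_space show ?thesis by simp
qed

text \<open>The function of \<open>t\<close> given by the total of \<open>q\<^sub>i + t (p\<^sub>i - q\<^sub>i)\<close> is affine, so the parameter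
  that hits the prescribed total is explicit.\<close>

lemma ex_budget:
  fixes p q :: "'i \<Rightarrow> real"
  assumes "\<And>i. i \<in> I \<Longrightarrow> q i \<le> p i" and "sum q I \<le> \<alpha>" and "\<alpha> \<le> sum p I"
  obtains a where "\<And>i. i \<in> I \<Longrightarrow> q i \<le> a i" and "\<And>i. i \<in> I \<Longrightarrow> a i \<le> p i" and "sum a I = \<alpha>"
proof -
  \<comment> \<open>If both end points have the same total, then \<open>t = 0\<close> by the convention for division by zero,
    and this is a correct choice, as \<open>\<alpha>\<close> equals that total.\<close>
  define t where "t = (\<alpha> - sum q I) / (sum p I - sum q I)"
  have t: "0 \<le> t" "t \<le> 1"
    unfolding t_def using assms(2,3) by (auto simp: divide_le_eq_1)
  show ?thesis
  proof (rule that[of "\<lambda>i. q i + t * (p i - q i)"])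
    fix i assume i: "i \<in> I"
    show "q i \<le> q i + t * (p i - q i)" using t assms(1)[OF i] by simp
    have "t * (p i - q i) \<le> 1 * (p i - q i)"
      using t assms(1)[OF i] by (intro mult_right_mono) auto
    then show "q i + t * (p i - q i) \<le> p i" by simp
  next
    have "(\<Sum>i\<in>I. q i + t * (p i - q i)) = sum q I + t * (sum p I - sum q I)"
      by (simp add: sum.distrib sum_distrib_left[symmetric] sum_subtractf)
    also have "\<dots> = \<alpha>" unfolding t_def using assms(2,3) by auto
    finally show "(\<Sum>i\<in>I. q i + t * (p i - q i)) = \<alpha>" .
  qed
qed

theorem theorem5p1:
  fixes M :: "'a measure" and N :: nat and p :: "nat \<Rightarrow> real" and \<alpha> :: real
    and X :: "'a \<Rightarrow> real" and Y :: "'a \<Rightarrow> nat"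
  assumes "prob_space M" and "finite (space M)"
    and "Y \<in> measurable M (count_space {1..N})"
    and "\<And>i. i \<in> {1..N} \<Longrightarrow> measure M {\<omega> \<in> space M. Y \<omega> = i} = p i"
    and "\<And>i. i \<in> {1..N} \<Longrightarrow> p i > 0"
    and "0 \<le> \<alpha>" and "\<alpha> \<le> 1"
    and "X \<in> borel_measurable M"
  shows "VaR M \<alpha> X =
      Sup {Min ((\<lambda>i. cond_VaR M (\<alpha> * \<zeta> i * inverse (p i)) X Y i) ` {1..N}) | \<zeta>.
             \<zeta> \<in> prob_simplex N \<and> (\<forall>i\<in>{1..N}. \<alpha> * \<zeta> i \<le> p i)}
    \<and> (\<forall>\<zeta>\<in>prob_simplex N. (\<forall>i\<in>{1..N}. \<alpha> * \<zeta> i \<le> p i) \<longrightarrow>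
         (\<forall>i\<in>{1..N}. cond_VaR M (\<alpha> * \<zeta> i * inverse (p i)) X Y i = \<infinity>) \<longrightarrow> \<alpha> = 1)"
proof -
  interpret prob_space M by fact
  note X [measurable] = assms(8)
  define A where "A i = {\<omega> \<in> space M. Y \<omega> = i}" for i
  define q where "q z i = measure M {\<omega> \<in> space M. X \<omega> < z \<and> Y \<omega> = i}" for z i
  let ?feasible = "\<lambda>\<zeta>. \<zeta> \<in> prob_simplex N \<and> (\<forall>i\<in>{1..N}. \<alpha> * \<zeta> i \<le> p i)"
  let ?V = "\<lambda>\<zeta> i. cond_VaR M (\<alpha> * \<zeta> i * inverse (p i)) X Y i"
  have Y_range: "Y \<omega> \<in> {1..N}" if "\<omega> \<in> space M" for \<omega>
    using measurable_space[OF assms(3) that] by simp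
  have A_sets [measurable]: "A i \<in> sets M" if "i \<in> {1..N}" for i
  proof -
    have "A i = Y -` {i} \<inter> space M" by (auto simp: A_def)
    with measurable_sets[OF assms(3), of "{i}"] that show ?thesis by simp
  qed
  have meas_A: "measure M (A i) = p i" if "i \<in> {1..N}" for i
    using assms(4)[OF that] by (simp add: A_def)
  have A_pos: "emeasure M (A i) \<noteq> 0" if "i \<in> {1..N}" for i
    using meas_A[OF that] assms(5)[OF that] by (auto simp: emeasure_eq_measure)
  have prob_cond: "prob_space (uniform_measure M (A i))" if "i \<in> {1..N}" for i
    using A_pos[OF that] by (intro prob_space_uniform_measure) auto
  have total: "(\<Sum>i=1..N. measure M {\<omega> \<in> space M. P \<omega> \<and> Y \<omega> = i}) = measure M {\<omega> \<in> space M. P \<omega>}"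
    if P: "{\<omega> \<in> space M. P \<omega>} \<in> sets M" for P
  proof -
    have eq: "{\<omega> \<in> space M. P \<omega> \<and> Y \<omega> = i} = {\<omega> \<in> space M. P \<omega>} \<inter> A i" for i
      by (auto simp: A_def)
    have "measure M (\<Union>i\<in>{1..N}. {\<omega> \<in> space M. P \<omega>} \<inter> A i) =
        (\<Sum>i=1..N. measure M ({\<omega> \<in> space M. P \<omega>} \<inter> A i))"
      using P A_sets by (intro finite_measure_finite_Union) (auto simp: disjoint_family_on_def A_def)
    moreover have "(\<Union>i\<in>{1..N}. {\<omega> \<in> space M. P \<omega>} \<inter> A i) = {\<omega> \<in> space M. P \<omega>}"
      using Y_range by (auto simp: A_def)
    ultimately show ?thesis by (simp add: eq)
  qed
  have sum_q: "sum (q z) {1..N} = measure M {\<omega> \<in> space M. X \<omega> < z}" for z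
    unfolding q_def by (intro total) measurable
  have sum_p: "sum p {1..N} = 1"
    using total[of "\<lambda>_. True"] assms(4) prob_space by simp
  have q_nonneg: "0 \<le> q z i" for z i
    by (simp add: q_def)
  have q_le_p: "q z i \<le> p i" if "i \<in> {1..N}" for z i
    unfolding q_def meas_A[OF that, symmetric]
    using A_sets[OF that] by (intro finite_measure_mono) (auto simp: A_def)
  \<comment> \<open>The threshold condition for \<open>?V \<zeta> i\<close>, cleared of the denominator.\<close>
  have threshold:
    "measure (uniform_measure M (A i)) {\<omega> \<in> space (uniform_measure M (A i)). X \<omega> < z}
        \<le> c * inverse (p i) \<longleftrightarrow> q z i \<le> c" if i: "i \<in> {1..N}" for i z c
  proof -
    have "A i \<inter> {\<omega> \<in> space M. X \<omega> < z} = {\<omega> \<in> space M. X \<omega> < z \<and> Y \<omega> = i}"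
      by (auto simp: A_def)
    then have "measure (uniform_measure M (A i)) {\<omega> \<in> space M. X \<omega> < z} = q z i / p i"
      using A_pos[OF i] meas_A[OF i] by (subst measure_uniform_measure) (auto simp: q_def)
    then show ?thesis
      using assms(5)[OF i] by (simp add: field_simps)
  qed
  have upper: "Min (?V \<zeta> ` {1..N}) \<le> VaR M \<alpha> X" if "?feasible \<zeta>" for \<zeta>
  proof (rule ccontr)
    assume "\<not> ?thesis"
    then obtain z where z: "VaR M \<alpha> X < ereal z" "ereal z < Min (?V \<zeta> ` {1..N})"
      using ereal_dense2 unfolding not_le by blast
    have sum_\<zeta>: "sum \<zeta> {1..N} = 1"
      using that by (simp add: prob_simplex_def)
    then have "{1..N} \<noteq> {}" by (metis sum.empty zero_neq_one)
    with z(2) have less: "ereal z < ?V \<zeta> i" if "i \<in> {1..N}" for i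
      using that by (subst (asm) Min_gr_iff) auto
    have "q z i \<le> \<alpha> * \<zeta> i" if i: "i \<in> {1..N}" for i
    proof -
      interpret C: prob_space "uniform_measure M (A i)" by (rule prob_cond[OF i])
      show ?thesis
        using C.measure_le_if_less_VaR[of X z "\<alpha> * \<zeta> i * inverse (p i)"] less[OF i]
          threshold[OF i, of z "\<alpha> * \<zeta> i"]
        by (simp add: cond_VaR_def A_def)
    qed
    then have "sum (q z) {1..N} \<le> (\<Sum>i=1..N. \<alpha> * \<zeta> i)" by (intro sum_mono)
    then have "ereal z \<le> VaR M \<alpha> X"
      unfolding sum_q sum_distrib_left[symmetric] sum_\<zeta> by (intro le_VaR) simp
    with z(1) show False by simp
  qed
  have lower: "\<exists>\<zeta>. ?feasible \<zeta> \<and> ereal z \<le> Min (?V \<zeta> ` {1..N})"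
    if z: "measure M {\<omega> \<in> space M. X \<omega> < z} \<le> \<alpha>" for z
  proof -
    have bounds: "sum (q z) {1..N} \<le> \<alpha>" "\<alpha> \<le> sum p {1..N}"
      using z assms(7) unfolding sum_q sum_p by auto
    obtain a where a: "\<And>i. i \<in> {1..N} \<Longrightarrow> q z i \<le> a i" "\<And>i. i \<in> {1..N} \<Longrightarrow> a i \<le> p i"
        "sum a {1..N} = \<alpha>"
      using ex_budget[OF q_le_p bounds] by blast
    have a_nonneg: "0 \<le> a i" if "i \<in> {1..N}" for i
      using q_nonneg[of z i] a(1)[OF that] by simp
    \<comment> \<open>For \<open>\<alpha> = 0\<close> the budget is zero and any point of the simplex represents it, such as \<open>p\<close>.\<close>
    define \<zeta> where "\<zeta> = restrict (\<lambda>i. if \<alpha> = 0 then p i else a i / \<alpha>) {1..N}"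
    have \<zeta>: "\<alpha> * \<zeta> i = a i" if "i \<in> {1..N}" for i
      using sum_nonneg_0[of "{1..N}" a, OF _ a_nonneg _ that] a(3) that
      by (cases "\<alpha> = 0") (simp_all add: \<zeta>_def)
    have "(\<Sum>i=1..N. \<zeta> i) = 1"
      using a(3) sum_p by (cases "\<alpha> = 0") (simp_all add: \<zeta>_def sum_divide_distrib[symmetric])
    moreover have "\<zeta> \<in> {1..N} \<rightarrow>\<^sub>E {0..}"
      using a_nonneg assms(5,6) by (auto simp: \<zeta>_def less_imp_le)
    ultimately have feasible: "?feasible \<zeta>"
      using a(2) \<zeta> by (simp add: prob_simplex_def)
    have "ereal z \<le> ?V \<zeta> i" if i: "i \<in> {1..N}" for i
      using threshold[OF i, of z "\<alpha> * \<zeta> i"] a(1)[OF i] \<zeta>[OF i]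
      unfolding cond_VaR_def A_def[symmetric] by (intro le_VaR) simp
    moreover have "{1..N} \<noteq> {}" using sum_p by (metis sum.empty zero_neq_one)
    ultimately have "ereal z \<le> Min (?V \<zeta> ` {1..N})" by (subst Min_ge_iff) auto
    with feasible show ?thesis by blast
  qed
  have "VaR M \<alpha> X = Sup {Min (?V \<zeta> ` {1..N}) | \<zeta>. ?feasible \<zeta>}"
  proof (rule antisym)
    show "VaR M \<alpha> X \<le> Sup {Min (?V \<zeta> ` {1..N}) | \<zeta>. ?feasible \<zeta>}"
      unfolding VaR_def[of M] by (rule Complete_Lattices.Sup_mono) (use lower in blast)
    show "Sup {Min (?V \<zeta> ` {1..N}) | \<zeta>. ?feasible \<zeta>} \<le> VaR M \<alpha> X"
      by (rule Sup_least) (use upper in blast)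
  qed
  moreover have "\<alpha> = 1" if \<zeta>: "\<zeta> \<in> prob_simplex N" and inf: "\<forall>i\<in>{1..N}. ?V \<zeta> i = \<infinity>" for \<zeta>
  proof -
    have "p i \<le> \<alpha> * \<zeta> i" if i: "i \<in> {1..N}" for i
    proof -
      interpret C: prob_space "uniform_measure M (A i)" by (rule prob_cond[OF i])
      have "1 \<le> \<alpha> * \<zeta> i * inverse (p i)"
        using C.one_le_level_if_VaR_infinite[of X] inf i assms(2)
        by (simp add: cond_VaR_def A_def)
      then show ?thesis using assms(5)[OF i] by (simp add: field_simps)
    qed
    then have "sum p {1..N} \<le> (\<Sum>i=1..N. \<alpha> * \<zeta> i)" by (intro sum_mono)
    then show ?thesis
      unfolding sum_p sum_distrib_left[symmetric] using \<zeta> assms(7) by (simp add: prob_simplex_def)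
  qed
  ultimately show ?thesis by blast
qed

end
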